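(* For $n\ge1$ let $X\in\mathbb{M}_1(n)$ with $p_n>0$, where $p_k=P(X=k)$. Then $\rho(X)\ge p_n^{1/n}>0$, and for $\alpha\in(0,1]$, $X\in\mathbb{M}_\alpha(n)$ if and only if $p_j^\star(\alpha)\ge0$ for all $j\in\{0,1,\ldots,n-1\}$, in which case $X\sim\alpha\circ Z$ with $P(Z=j)=p_j^\star(\alpha)$ for $j\in\{0,1,\ldots,n\}$.
   Context: Notation. $\mathbb{M}_1$ is the family of all probability distributions supported in $\mathbb{Z}_+=\{0,1,2,\ldots\}$; $X\in\mathbb{M}_1$ means that the distribution of the random variable $X$ is in $\mathbb{M}_1$ (and similarly for the other classes). $\sim$ means equality in distribution. For $X\in\mathbb{M}_1$ and $\alpha\in[0,1]$, $\alpha\circ X$ denotes a random variable distributed as $\sum_{i=1}^X B_i$ (empty sum $=0$), where $B_1,B_2,\ldots$ are i.i.d. with $P(B_i=1)=\alpha=1-P(B_i=0)$, independent of $X$. $\mathbb{M}_\alpha$ is the set of all distributions of $\alpha\circ Z$ with $Z\in\mathbb{M}_1$. $\mathbb{M}_\alpha(n)$ is the set of those distributions in $\mathbb{M}_\alpha$ whose support is contained in $\{0,1,\ldots,n\}$. For $X\in\mathbb{M}_1$, $\rho(X)=\inf\{\alpha\in[0,1]: X\in\mathbb{M}_\alpha\}$. For $X\in\mathbb{M}_1(n)$, $\alpha\in(0,1]$ and $0\le j\le n$, $$p_j^\star(\alpha)=\sum_{k=j}^n\binom{k}{j}\alpha^{-k}(\alpha-1)^{k-j}p_k,\qquad p_k=P(X=k),$$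 with the convention $0^0=1$. *)

theory Defs
  imports "HOL-Probability.Probability"
begin

text \<open>
  Distributions supported in the non-negative integers are elements of \<open>nat pmf\<close>; equality in
  distribution is equality of such elements.
\<close>

text \<open>
  The law of \<open>B\<^sub>1 + \<dots> + B\<^sub>X\<close>, where the \<open>B\<^sub>i\<close> are i.i.d. with
  \<open>P(B\<^sub>i = 1) = \<alpha> = 1 - P(B\<^sub>i = 0)\<close> and independent of \<open>X\<close>: by independence, it is the mixture
  over the values \<open>k\<close> of \<open>X\<close> of the laws of \<open>B\<^sub>1 + \<dots> + B\<^sub>k\<close>. Only meant for
  \<open>\<alpha> \<in> {0..1}\<close>; \<^term>\<open>bernoulli_pmf \<alpha>\<close> truncates \<open>\<alpha>\<close> to that interval.
\<close>

definition thinning :: "real \<Rightarrow> nat pmf \<Rightarrow> nat pmf" (infixr "\<circ>\<^sub>t" 75) where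
  "\<alpha> \<circ>\<^sub>t X =
     bind_pmf X (\<lambda>k. map_pmf sum_list (replicate_pmf k (map_pmf of_bool (bernoulli_pmf \<alpha>))))"

definition thinned :: "real \<Rightarrow> nat pmf set" where
  "thinned \<alpha> = {\<alpha> \<circ>\<^sub>t Z | Z. True}"

definition thinned_upto :: "real \<Rightarrow> nat \<Rightarrow> nat pmf set" where
  "thinned_upto \<alpha> n = {X \<in> thinned \<alpha>. set_pmf X \<subseteq> {0..n}}"

text \<open>
  The infimum is over a non-empty set bounded below, since \<open>1\<close> belongs to it
  (\<open>thinned_1\<close> below).
\<close>

definition rho :: "nat pmf \<Rightarrow> real" where
  "rho X = Inf {\<alpha> \<in> {0..1}. X \<in> thinned \<alpha>}"

definition p_star :: "nat \<Rightarrow> nat pmf \<Rightarrow> real \<Rightarrow> nat \<Rightarrow> real" where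
  "p_star n X \<alpha> j =
     (\<Sum>k=j..n. real (k choose j) * \<alpha> powi (- int k) * (\<alpha> - 1) ^ (k - j) * pmf X k)"

lemma thinning_eq_binomial:
  assumes "\<alpha> \<in> {0..1}"
  shows "\<alpha> \<circ>\<^sub>t X = bind_pmf X (\<lambda>k. binomial_pmf k \<alpha>)"
proof -
  have "map_pmf sum_list (replicate_pmf k (map_pmf of_bool (bernoulli_pmf \<alpha>))) = binomial_pmf k \<alpha>" for k
  proof (induction k)
    case 0
    then show ?case
      using assms by (simp add: binomial_pmf_0)
  next
    case (Suc k)
    show ?case
      unfolding binomial_pmf_Suc[OF assms] Suc.IH[symmetric]
      by (auto simp: map_pmf_def bind_return_pmf bind_assoc_pmf intro!: bind_pmf_cong)
  qed
  then show ?thesis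
    unfolding thinning_def by simp
qed

lemma thinned_1: "thinned 1 = UNIV"
proof -
  have "binomial_pmf k 1 = return_pmf k" for k :: nat
    using set_pmf_binomial_1[of k] by (simp only: set_pmf_subset_singleton[symmetric] order_refl)
  then have "1 \<circ>\<^sub>t Z = Z" for Z
    by (simp add: thinning_eq_binomial bind_return_pmf')
  then show ?thesis
    by (force simp: thinned_def)
qed

end

theory Submission
  imports Defs
begin

text \<open>
  Thinning by \<open>\<alpha>\<close> sends the mass function \<open>q\<close> of a distribution on \<open>{0,\<dots>,n}\<close> to
  \<open>T\<^sub>\<alpha> q\<close>, where \<open>T\<^sub>\<alpha>\<close> is the linear operator whose kernel consists of the binomial weights
  \<open>(k choose j) \<alpha>\<^sup>j (1 - \<alpha>)\<^bsup>k-j\<^esup>\<close>. These weights are polynomial in \<open>\<alpha>\<close>, so \<open>T\<^sub>\<alpha>\<close> makes sense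
  for every real \<open>\<alpha>\<close>, and the semigroup law \<open>T\<^sub>\<alpha> T\<^sub>\<beta> = T\<^bsub>\<alpha>\<beta>\<^esub>\<close>, known for thinnings, is a
  polynomial identity that holds for all parameters (\<open>binomial_weight_semigroup\<close>,
  \<open>weighted_sum_compose\<close>). Since \<open>T\<^sub>1\<close> is the identity, \<open>T\<^bsub>1/\<alpha>\<^esub>\<close> inverts \<open>T\<^sub>\<alpha>\<close>.

  The point is that the numbers \<open>p\<^sub>j\<^sup>\<star>(\<alpha>)\<close> are precisely \<open>T\<^bsub>1/\<alpha>\<^esub> p\<close>
  (\<open>p_star_eq_weighted_sum\<close>). They are therefore the only possible mass function of a \<open>Z\<close> with
  \<open>X = \<alpha> \<circ> Z\<close>, and they sum to \<open>1\<close> because every row of the kernel does. So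
  such a \<open>Z\<close> exists exactly when they are non-negative; the last one equals
  \<open>\<alpha>\<^bsup>-n\<^esup> p\<^sub>n > 0\<close>, which is why only \<open>j < n\<close> has to be tested. This last number is a
  probability, hence at most \<open>1\<close>, whenever \<open>Z\<close> exists, that is \<open>p\<^sub>n \<le> \<alpha>\<^sup>n\<close>, and this bounds \<open>\<rho>(X)\<close> from below.
\<close>

section \<open>Binomial weights\<close>

definition binomial_weight :: "'a::comm_ring_1 \<Rightarrow> nat \<Rightarrow> nat \<Rightarrow> 'a" where
  "binomial_weight a k j = of_nat (k choose j) * a ^ j * (1 - a) ^ (k - j)"

lemma binomial_weight_eq_0: "k < j \<Longrightarrow> binomial_weight a k j = 0"
  by (simp add: binomial_weight_def binomial_eq_0)

lemma binomial_weight_1: "binomial_weight 1 k j = (if k = j then 1 else 0)"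
  by (cases k j rule: linorder_cases) (auto simp: binomial_weight_def binomial_eq_0 power_0_left)

lemma sum_binomial_weight:
  assumes "k \<le> n"
  shows "(\<Sum>j\<le>n. binomial_weight a k j) = 1"
proof -
  have "(\<Sum>j\<le>n. binomial_weight a k j) = (\<Sum>j\<le>k. binomial_weight a k j)"
    using assms by (intro sum.mono_neutral_right) (auto simp: binomial_weight_eq_0)
  also have "\<dots> = (a + (1 - a)) ^ k"
    by (simp only: binomial_weight_def binomial_ring)
  finally show ?thesis
    by simp
qed

text \<open>
  For \<open>a, b \<in> [0,1]\<close> this says that keeping each of \<open>m\<close> items with probability \<open>b\<close>, and each
  survivor with probability \<open>a\<close>, keeps each item with probability \<open>ab\<close>. The algebraic reason,
  valid in any commutative ring: choosing \<open>k\<close> of \<open>m\<close> and then \<open>j\<close> of these \<open>k\<close> is choosing the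
  \<open>j\<close> final items first and the \<open>k - j\<close> intermediate ones among the other \<open>m - j\<close>, and the sum
  over the latter is the binomial expansion of \<open>(b(1 - a) + (1 - b))\<^bsup>m-j\<^esup>\<close>.
\<close>

lemma binomial_weight_semigroup:
  assumes "m \<le> n"
  shows "(\<Sum>k\<le>n. binomial_weight a k j * binomial_weight b m k) = binomial_weight (a * b) m j"
proof (cases "j \<le> m")
  case True
  have weight_product: "binomial_weight a (i + j) j * binomial_weight b m (i + j) =
      of_nat (m choose j) * (a * b) ^ j *
        (of_nat ((m - j) choose i) * (b * (1 - a)) ^ i * (1 - b) ^ (m - j - i))"
    if "i \<le> m - j" for i
  proof -
    have "(m choose (i + j)) * ((i + j) choose j) = (m choose j) * ((m - j) choose i)"
      using choose_mult[of j "i + j" m] that True by simp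
    then have "(of_nat (m choose (i + j)) * of_nat ((i + j) choose j) :: 'a) =
        of_nat (m choose j) * of_nat ((m - j) choose i)"
      by (metis of_nat_mult)
    moreover have "binomial_weight a (i + j) j * binomial_weight b m (i + j) =
        (of_nat (m choose (i + j)) * of_nat ((i + j) choose j)) *
          ((a * b) ^ j * (b * (1 - a)) ^ i * (1 - b) ^ (m - j - i))"
      by (simp add: binomial_weight_def power_add power_mult_distrib mult_ac add.commute)
    ultimately show ?thesis
      by (simp add: mult_ac)
  qed
  have "(\<Sum>k\<le>n. binomial_weight a k j * binomial_weight b m k) =
      (\<Sum>k=j..m. binomial_weight a k j * binomial_weight b m k)"
    using assms by (intro sum.mono_neutral_right) (auto simp: binomial_weight_eq_0)
  also have "\<dots> = (\<Sum>i\<le>m-j. binomial_weight a (i + j) j * binomial_weight b m (i + j))"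
    using True by (intro sum.reindex_bij_witness[of _ "\<lambda>i. i + j" "\<lambda>k. k - j"]) auto
  also have "\<dots> = of_nat (m choose j) * (a * b) ^ j *
      (\<Sum>i\<le>m-j. of_nat ((m - j) choose i) * (b * (1 - a)) ^ i * (1 - b) ^ (m - j - i))"
    by (simp add: weight_product sum_distrib_left)
  also have "\<dots> = of_nat (m choose j) * (a * b) ^ j * (b * (1 - a) + (1 - b)) ^ (m - j)"
    by (simp only: binomial_ring)
  also have "\<dots> = binomial_weight (a * b) m j"
    by (simp add: binomial_weight_def algebra_simps)
  finally show ?thesis .
next
  case False
  \<comment> \<open>every path from \<open>m\<close> down to \<open>k\<close> and on to \<open>j > m\<close> contains an upward step\<close>
  then have "binomial_weight a k j * binomial_weight b m k = 0" for k
    by (cases "k < j") (auto simp: binomial_weight_eq_0)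
  then show ?thesis
    using False by (simp add: binomial_weight_eq_0)
qed

section \<open>The semigroup of binomial operators\<close>

definition weighted_sum :: "nat \<Rightarrow> 'a::comm_ring_1 \<Rightarrow> (nat \<Rightarrow> 'a) \<Rightarrow> nat \<Rightarrow> 'a" where
  "weighted_sum n a q j = (\<Sum>k\<le>n. binomial_weight a k j * q k)"

lemma weighted_sum_1: "weighted_sum n 1 q j = (if j \<le> n then q j else 0)"
  by (simp add: weighted_sum_def binomial_weight_1 if_distrib[of "\<lambda>x. x * _"] cong: if_cong)

lemma weighted_sum_top: "weighted_sum n a q n = a ^ n * q n"
proof -
  have "weighted_sum n a q n = (\<Sum>k\<in>{n}. binomial_weight a k n * q k)"
    unfolding weighted_sum_def
    by (intro sum.mono_neutral_right) (auto simp: binomial_weight_eq_0)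
  then show ?thesis
    by (simp add: binomial_weight_def)
qed

lemma weighted_sum_compose:
  "weighted_sum n a (weighted_sum n b q) j = weighted_sum n (a * b) q j"
proof -
  have "weighted_sum n a (weighted_sum n b q) j =
      (\<Sum>k\<le>n. \<Sum>m\<le>n. binomial_weight a k j * binomial_weight b m k * q m)"
    by (simp add: weighted_sum_def sum_distrib_left mult.assoc)
  also have "\<dots> = (\<Sum>m\<le>n. (\<Sum>k\<le>n. binomial_weight a k j * binomial_weight b m k) * q m)"
    by (subst sum.swap) (simp add: sum_distrib_right)
  also have "\<dots> = weighted_sum n (a * b) q j"
    by (simp add: weighted_sum_def binomial_weight_semigroup)
  finally show ?thesis .
qed

lemma sum_weighted_sum: "(\<Sum>j\<le>n. weighted_sum n a q j) = (\<Sum>k\<le>n. q k)"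
proof -
  have "(\<Sum>j\<le>n. weighted_sum n a q j) = (\<Sum>k\<le>n. (\<Sum>j\<le>n. binomial_weight a k j) * q k)"
    unfolding weighted_sum_def by (subst sum.swap) (simp add: sum_distrib_right)
  then show ?thesis
    by (simp add: sum_binomial_weight)
qed

lemma weighted_sum_cong: "(\<And>k. k \<le> n \<Longrightarrow> q k = r k) \<Longrightarrow> weighted_sum n a q j = weighted_sum n a r j"
  by (simp add: weighted_sum_def)

section \<open>Thinning in terms of mass functions\<close>

text \<open>
  The powers in \<^const>\<open>p_star\<close> regroup as \<open>\<alpha>\<^bsup>-k\<^esup> (\<alpha> - 1)\<^bsup>k-j\<^esup> = (1/\<alpha>)\<^sup>j (1 - 1/\<alpha>)\<^bsup>k-j\<^esup>\<close>: they are
  the binomial weights with the (improper) parameter \<open>1/\<alpha> \<ge> 1\<close>.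
\<close>

lemma p_star_eq_weighted_sum:
  assumes "\<alpha> > 0"
  shows "p_star n X \<alpha> j = weighted_sum n (inverse \<alpha>) (pmf X) j"
proof -
  have "\<alpha> powi (- int k) * (\<alpha> - 1) ^ (k - j) = inverse \<alpha> ^ j * (1 - inverse \<alpha>) ^ (k - j)"
    if "j \<le> k" for k
  proof -
    have "1 - inverse \<alpha> = inverse \<alpha> * (\<alpha> - 1)"
      using assms by (simp add: field_simps)
    moreover have "\<alpha> powi (- int k) = inverse \<alpha> ^ k"
      by (simp add: power_int_minus power_inverse)
    moreover have "inverse \<alpha> ^ k = inverse \<alpha> ^ j * inverse \<alpha> ^ (k - j)"
      using that by (simp only: power_add[symmetric] le_add_diff_inverse)
    ultimately show ?thesis
      by (simp add: power_mult_distrib)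
  qed
  then have "p_star n X \<alpha> j = (\<Sum>k=j..n. binomial_weight (inverse \<alpha>) k j * pmf X k)"
    unfolding p_star_def binomial_weight_def by (intro sum.cong) (auto simp: mult.assoc)
  also have "\<dots> = weighted_sum n (inverse \<alpha>) (pmf X) j"
    unfolding weighted_sum_def
    by (intro sum.mono_neutral_left) (auto simp: binomial_weight_eq_0)
  finally show ?thesis .
qed

lemma pmf_thinning:
  assumes "\<alpha> \<in> {0..1}" and "set_pmf Z \<subseteq> {0..n}"
  shows "pmf (\<alpha> \<circ>\<^sub>t Z) j = weighted_sum n \<alpha> (pmf Z) j"
proof -
  have "pmf (\<alpha> \<circ>\<^sub>t Z) j = (\<Sum>k\<le>n. pmf (binomial_pmf k \<alpha>) j * pmf Z k)"
    unfolding thinning_eq_binomial[OF assms(1)] pmf_bind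
    using assms(2) by (intro integral_measure_pmf_real) auto
  then show ?thesis
    using assms(1) by (simp add: weighted_sum_def binomial_weight_def)
qed

text \<open>
  With positive probability all of the \<open>Z\<close> items survive, so thinning cannot shrink the support.
\<close>

lemma set_pmf_subset_thinning:
  assumes "\<alpha> \<in> {0<..1}"
  shows "set_pmf Z \<subseteq> set_pmf (\<alpha> \<circ>\<^sub>t Z)"
proof -
  have "k \<in> set_pmf (binomial_pmf k \<alpha>)" for k
    using assms by (simp add: set_pmf_iff)
  moreover have "\<alpha> \<circ>\<^sub>t Z = bind_pmf Z (\<lambda>k. binomial_pmf k \<alpha>)"
    using assms by (intro thinning_eq_binomial) auto
  ultimately show ?thesis
    by auto
qed

lemma thinning_0: "0 \<circ>\<^sub>t Z = return_pmf 0"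
proof -
  have "binomial_pmf k 0 = return_pmf 0" for k
    using set_pmf_binomial_0[of k] by (simp only: set_pmf_subset_singleton[symmetric] order_refl)
  then show ?thesis
    by (simp add: thinning_eq_binomial)
qed

lemma p_star_thinning:
  assumes "\<alpha> \<in> {0<..1}" and "set_pmf (\<alpha> \<circ>\<^sub>t Z) \<subseteq> {0..n}" and "j \<le> n"
  shows "p_star n (\<alpha> \<circ>\<^sub>t Z) \<alpha> j = pmf Z j"
proof -
  have "set_pmf Z \<subseteq> {0..n}"
    using set_pmf_subset_thinning[OF assms(1)] assms(2) by blast
  then have "pmf (\<alpha> \<circ>\<^sub>t Z) = weighted_sum n \<alpha> (pmf Z)"
    using assms(1) by (intro ext pmf_thinning) auto
  then show ?thesis
    using assms by (simp add: p_star_eq_weighted_sum weighted_sum_compose weighted_sum_1)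
qed

section \<open>Which distributions are thinnings\<close>

lemma sum_pmf_atMost:
  fixes X :: "nat pmf"
  assumes "set_pmf X \<subseteq> {0..n}"
  shows "(\<Sum>k\<le>n. pmf X k) = 1"
  using assms by (intro sum_pmf_eq_1) auto

lemma exists_pmf_of_weights:
  fixes f :: "nat \<Rightarrow> real"
  assumes "\<And>j. j \<le> n \<Longrightarrow> f j \<ge> 0" and "(\<Sum>j\<le>n. f j) = 1"
  obtains Z where "set_pmf Z \<subseteq> {0..n}" and "\<And>j. j \<le> n \<Longrightarrow> pmf Z j = f j"
proof -
  define g where "g j = (if j \<le> n then f j else 0)" for j
  have g_nonneg: "g j \<ge> 0" for j
    using assms(1) by (simp add: g_def)
  have "(\<integral>\<^sup>+ j. ennreal (g j) \<partial>count_space UNIV) = (\<Sum>j\<le>n. ennreal (g j))"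
    by (intro nn_integral_count_space') (auto simp: g_def)
  also have "\<dots> = ennreal (\<Sum>j\<le>n. g j)"
    using g_nonneg by (intro sum_ennreal)
  also have "\<dots> = 1"
    using assms(2) by (simp add: g_def)
  finally have pmf_g: "pmf (embed_pmf g) j = g j" for j
    using g_nonneg by (intro pmf_embed_pmf)
  show thesis
  proof
    show "set_pmf (embed_pmf g) \<subseteq> {0..n}"
      by (auto simp: set_pmf_iff pmf_g g_def split: if_splits)
    show "pmf (embed_pmf g) j = f j" if "j \<le> n" for j
      using that by (simp add: pmf_g g_def)
  qed
qed

lemma exists_thinning_of_p_star_nonneg:
  assumes "\<alpha> \<in> {0<..1}" and "set_pmf X \<subseteq> {0..n}"
    and nonneg: "\<And>j. j < n \<Longrightarrow> p_star n X \<alpha> j \<ge> 0"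
  shows "\<exists>Z. X = \<alpha> \<circ>\<^sub>t Z"
proof -
  let ?q = "weighted_sum n (inverse \<alpha>) (pmf X)"
  have "?q j \<ge> 0" if "j \<le> n" for j
  proof (cases "j = n")
    case True
    then show ?thesis
      using assms(1) by (simp add: weighted_sum_top)
  next
    case False
    then show ?thesis
      using that nonneg[of j] assms(1) by (simp add: p_star_eq_weighted_sum)
  qed
  moreover have "(\<Sum>j\<le>n. ?q j) = 1"
    using assms(2) by (simp add: sum_weighted_sum sum_pmf_atMost)
  ultimately obtain Z where Z: "set_pmf Z \<subseteq> {0..n}" "\<And>j. j \<le> n \<Longrightarrow> pmf Z j = ?q j"
    using exists_pmf_of_weights[of n ?q] by blast
  have "pmf X j = pmf (\<alpha> \<circ>\<^sub>t Z) j" for j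
  proof -
    have "pmf (\<alpha> \<circ>\<^sub>t Z) j = weighted_sum n \<alpha> ?q j"
      using assms(1) Z by (simp add: pmf_thinning weighted_sum_cong[of n "pmf Z" ?q])
    also have "\<dots> = weighted_sum n 1 (pmf X) j"
      using assms(1) by (simp add: weighted_sum_compose)
    also have "\<dots> = pmf X j"
      using assms(2) by (auto simp: weighted_sum_1 set_pmf_iff)
    finally show ?thesis ..
  qed
  then show ?thesis
    by (blast intro: pmf_eqI)
qed

text \<open>
  The largest value \<open>n\<close> of \<open>X\<close> is reached only if \<open>Z = n\<close> and all \<open>n\<close> items survive, so
  \<open>p\<^sub>n = \<alpha>\<^sup>n P(Z = n) \<le> \<alpha>\<^sup>n\<close>.
\<close>

lemma root_pmf_top_le_rho:
  assumes "n \<ge> 1" and "set_pmf X \<subseteq> {0..n}" and "pmf X n > 0"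
  shows "pmf X n powr (1 / real n) \<le> rho X"
  unfolding rho_def
proof (rule cInf_greatest)
  show "{\<alpha> \<in> {0..1}. X \<in> thinned \<alpha>} \<noteq> {}"
    using thinned_1 by (auto intro!: exI[of _ 1])
next
  fix \<alpha> assume "\<alpha> \<in> {\<alpha> \<in> {0..1}. X \<in> thinned \<alpha>}"
  then obtain Z where \<alpha>: "\<alpha> \<in> {0..1}" and X: "X = \<alpha> \<circ>\<^sub>t Z"
    by (auto simp: thinned_def)
  have "\<alpha> \<noteq> 0"
    using assms(1,3) X by (auto simp: thinning_0)
  with \<alpha> have \<alpha>_pos: "\<alpha> \<in> {0<..1}"
    by auto
  then have "set_pmf Z \<subseteq> {0..n}"
    using set_pmf_subset_thinning X assms(2) by blast
  then have "pmf X n = \<alpha> ^ n * pmf Z n"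
    using \<alpha> X by (simp add: pmf_thinning weighted_sum_top)
  then have "pmf X n \<le> \<alpha> ^ n"
    using \<alpha>_pos by (simp add: mult_left_le pmf_le_1)
  then have "pmf X n powr (1 / real n) \<le> (\<alpha> ^ n) powr (1 / real n)"
    by (intro powr_mono2) auto
  also have "\<dots> = \<alpha>"
    using assms(1) \<alpha>_pos by (simp add: powr_powr flip: powr_realpow)
  finally show "pmf X n powr (1 / real n) \<le> \<alpha>" .
qed

theorem theorem13:
  fixes n :: nat and X :: "nat pmf"
  assumes "n \<ge> 1"
    and "set_pmf X \<subseteq> {0..n}"
    and "pmf X n > 0"
  shows "rho X \<ge> pmf X n powr (1 / real n) \<and> pmf X n powr (1 / real n) > 0 \<and>
    (\<forall>\<alpha>\<in>{0<..1}.
       (X \<in> thinned_upto \<alpha> n \<longleftrightarrow> (\<forall>j\<in>{0..n-1}. p_star n X \<alpha> j \<ge> 0)) \<and>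
       (X \<in> thinned_upto \<alpha> n \<longrightarrow>
          (\<exists>Z. (\<forall>j\<in>{0..n}. pmf Z j = p_star n X \<alpha> j) \<and> X = \<alpha> \<circ>\<^sub>t Z)))"
proof (intro conjI ballI)
  show "rho X \<ge> pmf X n powr (1 / real n)"
    using assms by (rule root_pmf_top_le_rho)
  show "pmf X n powr (1 / real n) > 0"
    using assms(3) by simp
next
  fix \<alpha> :: real assume \<alpha>: "\<alpha> \<in> {0<..1}"
  have witness: "\<exists>Z. (\<forall>j\<in>{0..n}. pmf Z j = p_star n X \<alpha> j) \<and> X = \<alpha> \<circ>\<^sub>t Z"
    if X: "X \<in> thinned_upto \<alpha> n"
  proof -
    obtain Z where Z: "X = \<alpha> \<circ>\<^sub>t Z"
      using X by (auto simp: thinned_upto_def thinned_def)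
    then have "pmf Z j = p_star n X \<alpha> j" if "j \<le> n" for j
      using p_star_thinning[OF \<alpha>] assms(2) that by simp
    with Z show ?thesis
      by (intro exI[of _ Z]) simp
  qed
  then show "X \<in> thinned_upto \<alpha> n \<longrightarrow>
      (\<exists>Z. (\<forall>j\<in>{0..n}. pmf Z j = p_star n X \<alpha> j) \<and> X = \<alpha> \<circ>\<^sub>t Z)" ..
  show "X \<in> thinned_upto \<alpha> n \<longleftrightarrow> (\<forall>j\<in>{0..n-1}. p_star n X \<alpha> j \<ge> 0)"
  proof
    assume "X \<in> thinned_upto \<alpha> n"
    then obtain Z where Z: "\<forall>j\<in>{0..n}. pmf Z j = p_star n X \<alpha> j"
      using witness by blast
    show "\<forall>j\<in>{0..n-1}. p_star n X \<alpha> j \<ge> 0"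
    proof
      fix j assume "j \<in> {0..n-1}"
      then have "pmf Z j = p_star n X \<alpha> j"
        using Z by simp
      then show "p_star n X \<alpha> j \<ge> 0"
        by (metis pmf_nonneg)
    qed
  next
    assume "\<forall>j\<in>{0..n-1}. p_star n X \<alpha> j \<ge> 0"
    then have "\<exists>Z. X = \<alpha> \<circ>\<^sub>t Z"
      using \<alpha> assms(2) by (intro exists_thinning_of_p_star_nonneg) auto
    then show "X \<in> thinned_upto \<alpha> n"
      using assms(2) by (auto simp: thinned_upto_def thinned_def)
  qed
qed

end
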